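(* A class of matroids is complete if and only if it is closed under the operations of minors, duals, direct sums, and principal extension.
   Context: All matroids are finite; a class of matroids is a collection of matroids closed under isomorphism. A class of matroids is complete if it is closed under the operations of minors, duals, direct sums, truncations, and induction by directed graphs. Principal extension: for a matroid $M$ with rank function $r$, a subset $Y \subseteq E(M)$, and an element $e \notin E(M)$, the principal extension $M +_Y e$ is the matroid on $E(M)\cup\{e\}$ with rank function given, for $X \subseteq E(M)$, by $r_{M+_Y e}(X) = r(X)$ and $r_{M+_Y e}(X\cup \{e\}) = \min\{r(X)+1,\ r(X\cup Y)\}$. Truncation: the truncation of $M$ is $(M +_{E(M)} e)/e$. Induction by directed graphs: let $\Gamma$ be a (finite) directed graph and $M$ a matroid with $E(M)\subseteq V(\Gamma)$. The induced matroid $\Gamma(M)$ is the matroid on $V(\Gamma)$ in which a subset of $V(\Gamma)$ is independent if and only if it can be linked to an independent set of $M$; here $W$ is linked to $Z$ if $|W|=|Z|$ and there are $|W|$ pairwise vertex-disjoint directed paths (paths with a single vertex allowed) whose set of initial vertices is $W$ and whose set of terminal vertices is $Z$. *)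

theory Defs
  imports "Graph_Theory.Pair_Digraph" "Graph_Theory.Vertex_Walk"
begin

section \<open>Matroids\<close>

record 'a matroid_system =
  ground :: "'a set"
  indeps :: "'a set set"

definition matroid :: "'a matroid_system \<Rightarrow> bool" where
  "matroid M \<longleftrightarrow>
     finite (ground M) \<and>
     indeps M \<subseteq> Pow (ground M) \<and>
     {} \<in> indeps M \<and>
     (\<forall>I\<in>indeps M. \<forall>J. J \<subseteq> I \<longrightarrow> J \<in> indeps M) \<and>
     (\<forall>I\<in>indeps M. \<forall>J\<in>indeps M. card I < card J \<longrightarrow> (\<exists>x\<in>J - I. insert x I \<in> indeps M))"

definition rank :: "'a matroid_system \<Rightarrow> 'a set \<Rightarrow> nat" where
  "rank M X = Max (card ` {I \<in> indeps M. I \<subseteq> X})"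

definition bases :: "'a matroid_system \<Rightarrow> 'a set set" where
  "bases M = {B \<in> indeps M. \<forall>I\<in>indeps M. B \<subseteq> I \<longrightarrow> I = B}"

definition matroid_iso :: "'a matroid_system \<Rightarrow> 'a matroid_system \<Rightarrow> bool" where
  "matroid_iso M N \<longleftrightarrow>
     (\<exists>f. bij_betw f (ground M) (ground N) \<and>
          (\<forall>X. X \<subseteq> ground M \<longrightarrow> (X \<in> indeps M \<longleftrightarrow> f ` X \<in> indeps N)))"


section \<open>Operations\<close>

text \<open>The bases of the dual are the complements of the bases of the matroid.\<close>

definition dual :: "'a matroid_system \<Rightarrow> 'a matroid_system" where
  "dual M = \<lparr> ground = ground M,
              indeps = {I. \<exists>B\<in>bases M. I \<subseteq> ground M - B} \<rparr>"

definition delete :: "'a matroid_system \<Rightarrow> 'a set \<Rightarrow> 'a matroid_system" where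
  "delete M D = \<lparr> ground = ground M - D,
                  indeps = {I \<in> indeps M. I \<subseteq> ground M - D} \<rparr>"

definition contract :: "'a matroid_system \<Rightarrow> 'a set \<Rightarrow> 'a matroid_system" where
  "contract M C = dual (delete (dual M) C)"

definition minor_of :: "'a matroid_system \<Rightarrow> 'a matroid_system \<Rightarrow> bool" where
  "minor_of N M \<longleftrightarrow>
     (\<exists>C D. C \<subseteq> ground M \<and> D \<subseteq> ground M \<and> C \<inter> D = {} \<and> N = delete (contract M C) D)"

text \<open>Meaningful only if the two ground sets are disjoint.\<close>

definition direct_sum :: "'a matroid_system \<Rightarrow> 'a matroid_system \<Rightarrow> 'a matroid_system" where
  "direct_sum M N = \<lparr> ground = ground M \<union> ground N,
                      indeps = {I \<union> J | I J. I \<in> indeps M \<and> J \<in> indeps N} \<rparr>"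

definition principal_extension_rank ::
    "'a matroid_system \<Rightarrow> 'a set \<Rightarrow> 'a \<Rightarrow> 'a set \<Rightarrow> nat" where
  "principal_extension_rank M Y e X =
     (if e \<in> X then min (rank M (X - {e}) + 1) (rank M ((X - {e}) \<union> Y)) else rank M X)"

text \<open>The matroid with the above rank function: its independent sets are those whose rank
  equals their cardinality.\<close>

definition principal_extension ::
    "'a matroid_system \<Rightarrow> 'a set \<Rightarrow> 'a \<Rightarrow> 'a matroid_system" where
  "principal_extension M Y e =
     \<lparr> ground = insert e (ground M),
       indeps = {X. X \<subseteq> insert e (ground M) \<and> principal_extension_rank M Y e X = card X} \<rparr>"

text \<open>The argument \<open>e\<close> is an auxiliary element outside the ground set; the truncation does not
  depend on its choice.\<close>

definition truncation :: "'a matroid_system \<Rightarrow> 'a \<Rightarrow> 'a matroid_system" where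
  "truncation M e = contract (principal_extension M (ground M) e) {e}"

text \<open>
  A set \<open>P\<close> of directed paths links \<open>W\<close> to \<open>Z\<close>. Paths are nonempty lists of distinct vertices
  and may consist of a single vertex. Digraphs are taken without parallel arcs (loops are
  allowed), as multiplicities of arcs do not influence which vertex sequences are paths.
\<close>

definition linked :: "'a pair_pre_digraph \<Rightarrow> 'a set \<Rightarrow> 'a set \<Rightarrow> bool" where
  "linked G W Z \<longleftrightarrow>
     card W = card Z \<and>
     (\<exists>P. card P = card W \<and>
          (\<forall>p\<in>P. vpath p (with_proj G)) \<and>
          pairwise (\<lambda>p q. set p \<inter> set q = {}) P \<and>
          hd ` P = W \<and> last ` P = Z)"

definition induced_matroid :: "'a pair_pre_digraph \<Rightarrow> 'a matroid_system \<Rightarrow> 'a matroid_system" where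
  "induced_matroid G M =
     \<lparr> ground = pverts G,
       indeps = {W. W \<subseteq> pverts G \<and> (\<exists>Z\<in>indeps M. linked G W Z)} \<rparr>"


section \<open>Classes of matroids\<close>

text \<open>
  The ground sets of the members of a class are finite subsets of one type. If that type is
  infinite, every finite matroid has an isomorphic copy over it, and any two matroids have
  isomorphic copies with disjoint ground sets.
\<close>

definition matroid_class :: "'a matroid_system set \<Rightarrow> bool" where
  "matroid_class \<C> \<longleftrightarrow>
     (\<forall>M\<in>\<C>. matroid M) \<and>
     (\<forall>M\<in>\<C>. \<forall>N. matroid N \<longrightarrow> matroid_iso M N \<longrightarrow> N \<in> \<C>)"

definition closed_minors :: "'a matroid_system set \<Rightarrow> bool" where
  "closed_minors \<C> \<longleftrightarrow> (\<forall>M\<in>\<C>. \<forall>N. minor_of N M \<longrightarrow> N \<in> \<C>)"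

definition closed_duals :: "'a matroid_system set \<Rightarrow> bool" where
  "closed_duals \<C> \<longleftrightarrow> (\<forall>M\<in>\<C>. dual M \<in> \<C>)"

definition closed_direct_sums :: "'a matroid_system set \<Rightarrow> bool" where
  "closed_direct_sums \<C> \<longleftrightarrow>
     (\<forall>M\<in>\<C>. \<forall>N\<in>\<C>. ground M \<inter> ground N = {} \<longrightarrow> direct_sum M N \<in> \<C>)"

definition closed_truncations :: "'a matroid_system set \<Rightarrow> bool" where
  "closed_truncations \<C> \<longleftrightarrow> (\<forall>M\<in>\<C>. \<forall>e. e \<notin> ground M \<longrightarrow> truncation M e \<in> \<C>)"

definition closed_digraph_induction :: "'a matroid_system set \<Rightarrow> bool" where
  "closed_digraph_induction \<C> \<longleftrightarrow>
     (\<forall>M\<in>\<C>. \<forall>G. pair_fin_digraph G \<longrightarrow> ground M \<subseteq> pverts G \<longrightarrow> induced_matroid G M \<in> \<C>)"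

definition closed_principal_extension :: "'a matroid_system set \<Rightarrow> bool" where
  "closed_principal_extension \<C> \<longleftrightarrow>
     (\<forall>M\<in>\<C>. \<forall>Y e. Y \<subseteq> ground M \<longrightarrow> e \<notin> ground M \<longrightarrow> principal_extension M Y e \<in> \<C>)"

definition complete_class :: "'a matroid_system set \<Rightarrow> bool" where
  "complete_class \<C> \<longleftrightarrow>
     closed_minors \<C> \<and> closed_duals \<C> \<and> closed_direct_sums \<C> \<and>
     closed_truncations \<C> \<and> closed_digraph_induction \<C>"

end

theory Submission
  imports Defs
begin

text \<open>
  Both directions rest on reading path linkings as matchings. If \<open>V\<close> is the vertex set of a
  digraph, then \<open>W\<close> is linked to \<open>Z\<close> if and only if there is a bijection from \<open>V - Z\<close> to
  \<open>V - W\<close> that moves each vertex along an arc or fixes it (the linkage lemma of Ingleton and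
  Piff, \<open>linked_imp_matching\<close> and \<open>matching_imp_linked\<close>): the bijection maps a vertex of a path
  to its successor and fixes the vertices on no path; conversely, iterating the bijection from
  a vertex of \<open>W\<close> traces out a path to \<open>Z\<close>.

  A principal extension \<open>M +\<^sub>Y e\<close> is an induced matroid: give \<open>e\<close> an arc to each element of
  \<open>Y\<close>. In both matroids a set containing \<open>e\<close> is independent if and only if \<open>e\<close> can be replaced
  by a new element of \<open>Y\<close> so as to give an independent set of \<open>M\<close>
  (\<open>principal_extension_eq_induced_matroid\<close>).

  Conversely, let a class be closed under minors, duals and principal extensions. Truncations
  are by definition contractions of principal extensions. Adding elements \<open>u\<close> to \<open>M\<close> one by one
  by principal extensions on subsets \<open>A u\<close> of \<open>E(M)\<close> and then deleting \<open>E(M)\<close> leaves the matroid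
  whose independent sets are those that can be matched along \<open>A\<close> into independent sets of \<open>M\<close>;
  so the class is closed under induction by bipartite graphs (\<open>closed_bipartite_induction\<close>).
  This includes the addition of loops, so that the ground set of \<open>M\<close> may be taken to be all of
  \<open>V\<close>. By the linkage lemma, the complements of the bases of \<open>\<Gamma>(M)\<close> are then the sets of full size
  that are matched into complements of bases of \<open>M\<close>. Hence the dual of \<open>\<Gamma>(M)\<close> arises
  from the dual of \<open>M\<close> by bipartite induction
  (\<open>induced_matroid_eq_dual_bipartite_induced_dual\<close>), and \<open>\<Gamma>(M)\<close> lies in the class.
\<close>

section \<open>Bases, rank and duality\<close>

lemma matroidD:
  assumes "matroid M"
  shows "finite (ground M)" "indeps M \<subseteq> Pow (ground M)" "{} \<in> indeps M"
    and "\<And>I J. I \<in> indeps M \<Longrightarrow> J \<subseteq> I \<Longrightarrow> J \<in> indeps M"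
    and "\<And>I J. I \<in> indeps M \<Longrightarrow> J \<in> indeps M \<Longrightarrow> card I < card J
           \<Longrightarrow> \<exists>x\<in>J - I. insert x I \<in> indeps M"
  using assms unfolding matroid_def by blast+

lemma indep_subset_ground: "matroid M \<Longrightarrow> I \<in> indeps M \<Longrightarrow> I \<subseteq> ground M"
  using matroidD(2) by blast

lemma indep_finite: "matroid M \<Longrightarrow> I \<in> indeps M \<Longrightarrow> finite I"
  using indep_subset_ground matroidD(1) finite_subset by blast

lemma indeps_finite: "matroid M \<Longrightarrow> finite (indeps M)"
  using matroidD(1,2) finite_subset finite_Pow_iff by metis

lemma indep_card_le_rank:
  assumes "matroid M" "I \<in> indeps M" "I \<subseteq> X"
  shows "card I \<le> rank M X"
  unfolding rank_def using assms indeps_finite[OF assms(1)] by (intro Max_ge) auto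

lemma rank_attained:
  assumes "matroid M"
  obtains I where "I \<in> indeps M" "I \<subseteq> X" "card I = rank M X"
proof -
  have "rank M X \<in> card ` {I \<in> indeps M. I \<subseteq> X}"
    unfolding rank_def using indeps_finite[OF assms] matroidD(3)[OF assms]
    by (intro Max_in) auto
  then show thesis using that by auto
qed

lemma rank_le_card:
  assumes "matroid M" "finite X"
  shows "rank M X \<le> card X"
  using rank_attained[OF assms(1)] card_mono[OF assms(2)] by metis

lemma indep_iff_rank_eq_card:
  assumes "matroid M" "finite X"
  shows "X \<in> indeps M \<longleftrightarrow> rank M X = card X"
proof
  assume "X \<in> indeps M"
  then show "rank M X = card X"
    using indep_card_le_rank[OF assms(1)] rank_le_card[OF assms] by (metis order_antisym order_refl)
next
  assume "rank M X = card X"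
  then show "X \<in> indeps M"
    using rank_attained[OF assms(1), of X] card_subset_eq[OF assms(2)] by metis
qed

lemma indep_extends_to_basis:
  assumes "matroid M" "I \<in> indeps M"
  obtains B where "B \<in> bases M" "I \<subseteq> B"
proof -
  have "finite {J \<in> indeps M. I \<subseteq> J}"
    using indeps_finite[OF assms(1)] by simp
  then obtain B where "B \<in> {J \<in> indeps M. I \<subseteq> J}" "\<forall>J\<in>{J \<in> indeps M. I \<subseteq> J}. B \<subseteq> J \<longrightarrow> B = J"
    using finite_has_maximal2[of "{J \<in> indeps M. I \<subseteq> J}" I] assms(2) by auto
  then show thesis
    by (intro that[of B]) (auto simp: bases_def)
qed

lemma indep_card_le_basis_card:
  assumes "matroid M" "I \<in> indeps M" "B \<in> bases M"
  shows "card I \<le> card B"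
proof (rule ccontr)
  assume "\<not> card I \<le> card B"
  then obtain x where "x \<in> I - B" "insert x B \<in> indeps M"
    using matroidD(5)[OF assms(1), of B I] assms unfolding bases_def by auto
  then show False using assms(3) unfolding bases_def by auto
qed

lemma basis_subset_ground: "matroid M \<Longrightarrow> B \<in> bases M \<Longrightarrow> B \<subseteq> ground M"
  using indep_subset_ground unfolding bases_def by blast

lemma bases_dual:
  assumes "matroid M"
  shows "bases (dual M) = (\<lambda>B. ground M - B) ` bases M"
proof
  show "bases (dual M) \<subseteq> (\<lambda>B. ground M - B) ` bases M"
  proof
    fix D assume D: "D \<in> bases (dual M)"
    then obtain B where B: "B \<in> bases M" "D \<subseteq> ground M - B"
      unfolding bases_def[of "dual M"] by (auto simp: dual_def)
    then have "ground M - B \<in> indeps (dual M)"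
      by (auto simp: dual_def)
    then have "ground M - B = D"
      using D B(2) unfolding bases_def[of "dual M"] by blast
    then show "D \<in> (\<lambda>B. ground M - B) ` bases M"
      using B(1) by blast
  qed
next
  show "(\<lambda>B. ground M - B) ` bases M \<subseteq> bases (dual M)"
  proof
    fix D assume "D \<in> (\<lambda>B. ground M - B) ` bases M"
    then obtain B where B: "B \<in> bases M" "D = ground M - B" by blast
    have "I = D" if I: "D \<subseteq> I" "I \<subseteq> ground M - B'" "B' \<in> bases M" for I B'
    proof -
      have "B' \<subseteq> B"
        using I B(2) basis_subset_ground[OF assms I(3)] by blast
      then have "B' = B"
        using I(3) B(1) unfolding bases_def by auto
      then show ?thesis using I B by blast
    qed
    then show "D \<in> bases (dual M)"
      using B unfolding bases_def[of "dual M"] by (auto simp: dual_def)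
  qed
qed

lemma dual_dual:
  assumes "matroid M"
  shows "dual (dual M) = M"
proof -
  have "indeps (dual (dual M)) = {I. \<exists>B\<in>bases M. I \<subseteq> ground M - (ground M - B)}"
    unfolding dual_def[of "dual M"] bases_dual[OF assms] by (auto simp: dual_def)
  also have "\<dots> = {I. \<exists>B\<in>bases M. I \<subseteq> B}"
    using basis_subset_ground[OF assms] by blast
  also have "\<dots> = indeps M"
  proof (intro equalityI subsetI)
    fix I assume "I \<in> {I. \<exists>B\<in>bases M. I \<subseteq> B}"
    then show "I \<in> indeps M"
      using matroidD(4)[OF assms] unfolding bases_def by blast
  next
    fix I assume "I \<in> indeps M"
    then show "I \<in> {I. \<exists>B\<in>bases M. I \<subseteq> B}"
      using indep_extends_to_basis[OF assms] by (metis (mono_tags, lifting) mem_Collect_eq)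
  qed
  finally show ?thesis
    by (simp add: dual_def)
qed

text \<open>
  Minors are formed by contracting and then deleting, and contraction passes through the dual;
  that a mere deletion is a minor is therefore an instance of biduality.
\<close>

lemma minor_of_delete:
  assumes "matroid M" "D \<subseteq> ground M"
  shows "minor_of (delete M D) M"
proof -
  have "delete (dual M) {} = dual M"
    by (auto simp: delete_def dual_def)
  then have "contract M {} = M"
    by (simp add: contract_def dual_dual[OF assms(1)])
  then show ?thesis
    unfolding minor_of_def using assms(2) by (intro exI[of _ "{}"] exI[of _ D]) simp
qed

lemma minor_of_contract:
  assumes "C \<subseteq> ground M"
  shows "minor_of (contract M C) M"
proof -
  have "delete (contract M C) {} = contract M C"
    by (auto simp: contract_def delete_def dual_def)
  then show ?thesis
    unfolding minor_of_def using assms by (intro exI[of _ C] exI[of _ "{}"]) simp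
qed

text \<open>
  A class of matroids only absorbs isomorphic copies already known to be matroids, and this is how
  a copy constructed on another ground set is seen to be one.
\<close>

lemma matroid_iso_matroid:
  assumes M: "matroid M" and iso: "matroid_iso M N" and N: "indeps N \<subseteq> Pow (ground N)"
  shows "matroid N"
proof -
  obtain f where bij: "bij_betw f (ground M) (ground N)"
    and f: "\<And>X. X \<subseteq> ground M \<Longrightarrow> X \<in> indeps M \<longleftrightarrow> f ` X \<in> indeps N"
    using iso unfolding matroid_iso_def by blast
  have inj: "inj_on f (ground M)" and im: "f ` ground M = ground N"
    using bij unfolding bij_betw_def by auto
  have card_f: "card (f ` X) = card X" if "X \<subseteq> ground M" for X
    using card_image inj inj_on_subset that by blast
  have lift: "\<exists>X\<in>indeps M. X \<subseteq> ground M \<and> J = f ` X" if "J \<in> indeps N" for J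
  proof -
    have "J \<subseteq> f ` ground M" using that N im by blast
    then obtain X where "X \<subseteq> ground M" "J = f ` X" by (rule subset_imageE)
    then show ?thesis using f that by blast
  qed
  have "finite (ground N)" using matroidD(1)[OF M] im finite_imageI by metis
  moreover have "{} \<in> indeps N" using f[of "{}"] matroidD(3)[OF M] by simp
  moreover have "J \<in> indeps N" if I: "I \<in> indeps N" and J: "J \<subseteq> I" for I J
  proof -
    obtain X where X: "X \<in> indeps M" "X \<subseteq> ground M" "I = f ` X" using lift I by blast
    then obtain X' where X': "X' \<subseteq> X" "J = f ` X'" using subset_imageE J by metis
    then show ?thesis using X f matroidD(4)[OF M] by (metis order_trans)
  qed
  moreover have "\<exists>x\<in>J - I. insert x I \<in> indeps N"
    if IJ: "I \<in> indeps N" "J \<in> indeps N" "card I < card J" for I J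
  proof -
    obtain X where X: "X \<in> indeps M" "X \<subseteq> ground M" "I = f ` X" using lift IJ(1) by blast
    obtain X' where X': "X' \<in> indeps M" "X' \<subseteq> ground M" "J = f ` X'" using lift IJ(2) by blast
    have "card X < card X'" using IJ(3) X X' card_f by simp
    then obtain x where x: "x \<in> X' - X" "insert x X \<in> indeps M"
      using matroidD(5)[OF M X(1) X'(1)] by blast
    have "f x \<notin> f ` X"
      using x X X' inj by (auto dest!: inj_onD)
    moreover have "insert (f x) I \<in> indeps N"
      using f[of "insert x X"] x X X' by auto
    ultimately show ?thesis using x X X' by blast
  qed
  ultimately show ?thesis
    unfolding matroid_def using N by blast
qed


section \<open>Independent sets of a principal extension\<close>

text \<open>
  For \<open>e \<in> X\<close> the rank condition says that \<open>X - {e}\<close> is independent and does not span \<open>Y\<close>, so that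
  it can be augmented by an element of \<open>Y\<close>.
\<close>

lemma indep_principal_extension_iff:
  assumes M: "matroid M" and Y: "Y \<subseteq> ground M" and e: "e \<notin> ground M"
    and X: "X \<subseteq> insert e (ground M)"
  shows "X \<in> indeps (principal_extension M Y e) \<longleftrightarrow>
    (if e \<in> X then \<exists>y\<in>Y - X. insert y (X - {e}) \<in> indeps M else X \<in> indeps M)"
proof -
  have finX: "finite X" and finY: "finite Y"
    using X Y matroidD(1)[OF M] finite_subset by (blast, blast)
  have def: "X \<in> indeps (principal_extension M Y e) \<longleftrightarrow>
      principal_extension_rank M Y e X = card X"
    using X by (simp add: principal_extension_def)
  show ?thesis
  proof (cases "e \<in> X")
    case False
    then show ?thesis
      using def indep_iff_rank_eq_card[OF M finX] by (simp add: principal_extension_rank_def)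
  next
    case True
    let ?X = "X - {e}"
    have card_X: "card X = Suc (card ?X)"
      using True finX by (metis card_Suc_Diff1)
    have le: "rank M ?X \<le> card ?X"
      using rank_le_card[OF M] finX by simp
    have "X \<in> indeps (principal_extension M Y e) \<longleftrightarrow>
        ?X \<in> indeps M \<and> card ?X < rank M (?X \<union> Y)"
      unfolding def principal_extension_rank_def
      using True card_X le indep_iff_rank_eq_card[OF M, of ?X] finX by (auto simp: min_def)
    also have "\<dots> \<longleftrightarrow> (\<exists>y\<in>Y - X. insert y ?X \<in> indeps M)"
    proof
      assume *: "?X \<in> indeps M \<and> card ?X < rank M (?X \<union> Y)"
      obtain J where J: "J \<in> indeps M" "J \<subseteq> ?X \<union> Y" "card J = rank M (?X \<union> Y)"
        using rank_attained[OF M] by metis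
      then obtain y where "y \<in> J - ?X" "insert y ?X \<in> indeps M"
        using matroidD(5)[OF M, of ?X J] * by auto
      then show "\<exists>y\<in>Y - X. insert y ?X \<in> indeps M"
        using J(2) Y e by blast
    next
      assume "\<exists>y\<in>Y - X. insert y ?X \<in> indeps M"
      then obtain y where y: "y \<in> Y - X" "insert y ?X \<in> indeps M" by blast
      have "?X \<in> indeps M" using matroidD(4)[OF M y(2)] by blast
      moreover have "card (insert y ?X) \<le> rank M (?X \<union> Y)"
        using indep_card_le_rank[OF M y(2)] y(1) by blast
      ultimately show "?X \<in> indeps M \<and> card ?X < rank M (?X \<union> Y)"
        using y(1) finX by (simp add: card_insert_if)
    qed
    finally show ?thesis using True by simp
  qed
qed


section \<open>Linkings as matchings\<close>

lemma set_vwalk_arcs: "set (vwalk_arcs p) = {(p ! i, p ! Suc i) | i. Suc i < length p}"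
proof (induction p rule: vwalk_arcs.induct)
  case (3 x y xs)
  have "{(l ! i, l ! Suc i) | i. Suc i < length l} =
      insert (x, y) {((y # xs) ! i, (y # xs) ! Suc i) | i. Suc i < length (y # xs)}"
    if "l = x # y # xs" for l
  proof (intro equalityI subsetI, goal_cases)
    case (1 a)
    then obtain i where i: "a = (l ! i, l ! Suc i)" "Suc i < length l" by blast
    then show ?case using that by (cases i) auto
  next
    case (2 a)
    show ?case
    proof (cases "a = (x, y)")
      case True
      then show ?thesis using that by (intro CollectI exI[of _ 0]) simp
    next
      case False
      then obtain i where "a = ((y # xs) ! i, (y # xs) ! Suc i)" "Suc i < length (y # xs)"
        using 2 by blast
      then show ?thesis using that by (intro CollectI exI[of _ "Suc i"]) simp
    qed
  qed
  then show ?case using 3 by simp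
qed auto

lemma vpath_iff:
  "vpath p (with_proj G) \<longleftrightarrow> p \<noteq> [] \<and> distinct p \<and> set p \<subseteq> pverts G \<and>
     (\<forall>i. Suc i < length p \<longrightarrow> (p ! i, p ! Suc i) \<in> parcs G)"
  unfolding vpath_def vwalk_def set_vwalk_arcs by auto

text \<open>
  The bijection sends a vertex of a path to its successor and fixes all vertices off the paths.
  Vertices of \<open>Z\<close> are the ones without a successor, vertices of \<open>W\<close> those without a predecessor.
\<close>

lemma linked_imp_matching:
  assumes fin: "finite (pverts G)" and W: "W \<subseteq> pverts G" and Z: "Z \<subseteq> pverts G"
    and linked: "linked G W Z"
  obtains \<sigma> where "bij_betw \<sigma> (pverts G - Z) (pverts G - W)"
    "\<And>u. u \<in> pverts G - Z \<Longrightarrow> \<sigma> u = u \<or> (u, \<sigma> u) \<in> parcs G"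
proof -
  obtain P where P: "\<And>p. p \<in> P \<Longrightarrow> vpath p (with_proj G)"
      "pairwise (\<lambda>p q. set p \<inter> set q = {}) P" "hd ` P = W" "last ` P = Z"
    and card_eq: "card W = card Z"
    using linked unfolding linked_def by blast
  have path: "p \<noteq> []" "distinct p" "set p \<subseteq> pverts G"
      "\<And>i. Suc i < length p \<Longrightarrow> (p ! i, p ! Suc i) \<in> parcs G" if "p \<in> P" for p
    using P(1)[OF that] unfolding vpath_iff by auto
  have position: "p = q \<and> i = j"
    if "p \<in> P" "q \<in> P" "i < length p" "j < length q" "p ! i = q ! j" for p q i j
  proof -
    have "p ! i \<in> set p \<inter> set q" using that nth_mem by force
    then have "p = q" using P(2) that unfolding pairwise_def by blast
    then show ?thesis using that path(2) nth_eq_iff_index_eq by metis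
  qed
  \<comment> \<open>The vertices on no path count as their own successors.\<close>
  define succ where "succ u v \<longleftrightarrow> (\<exists>p\<in>P. \<exists>i. Suc i < length p \<and> u = p ! i \<and> v = p ! Suc i)
      \<or> (\<forall>p\<in>P. u \<notin> set p) \<and> v = u" for u v
  have "\<exists>v. succ u v" if u: "u \<in> pverts G - Z" for u
  proof (cases "\<exists>p\<in>P. u \<in> set p")
    case True
    then obtain p i where p: "p \<in> P" "i < length p" "u = p ! i" by (metis in_set_conv_nth)
    have "u \<noteq> last p" using u P(4) p(1) by blast
    then have "Suc i \<noteq> length p"
      using p(3) path(1)[OF p(1)] by (metis diff_Suc_1 last_conv_nth)
    then show ?thesis
      using p unfolding succ_def by (metis Suc_lessI)
  qed (auto simp: succ_def)
  then obtain \<sigma> where \<sigma>: "\<And>u. u \<in> pverts G - Z \<Longrightarrow> succ u (\<sigma> u)" by metis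
  have succ_inj: "u = u'" if "succ u v" "succ u' v" for u u' v
    using that position unfolding succ_def
    by (metis Suc_lessD diff_Suc_1 nth_mem)
  have succ_range: "v \<in> pverts G - W" if u: "u \<in> pverts G - Z" and "succ u v" for u v
    using \<open>succ u v\<close> unfolding succ_def
  proof (elim disjE bexE exE conjE)
    fix p i assume p: "p \<in> P" "Suc i < length p" "u = p ! i" "v = p ! Suc i"
    have "v \<noteq> hd q" if "q \<in> P" for q
      using position[OF p(1) that, of "Suc i" 0] p path(1)[OF that] hd_conv_nth[of q] by auto
    moreover have "v \<in> pverts G" using p path(3) nth_mem by blast
    ultimately show ?thesis using P(3) by blast
  next
    assume "\<forall>p\<in>P. u \<notin> set p" "v = u"
    then show ?thesis using u P(3) path(1) hd_in_set by blast
  qed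
  have "inj_on \<sigma> (pverts G - Z)"
    using \<sigma> succ_inj by (metis inj_onI)
  moreover have "\<sigma> ` (pverts G - Z) = pverts G - W"
  proof (rule card_subset_eq)
    show "\<sigma> ` (pverts G - Z) \<subseteq> pverts G - W" using \<sigma> succ_range by blast
    show "card (\<sigma> ` (pverts G - Z)) = card (pverts G - W)"
      using card_image[OF \<open>inj_on \<sigma> _\<close>] card_eq W Z fin
      by (simp add: card_Diff_subset finite_subset)
  qed (use fin in simp)
  ultimately have "bij_betw \<sigma> (pverts G - Z) (pverts G - W)"
    unfolding bij_betw_def by blast
  moreover have "\<sigma> u = u \<or> (u, \<sigma> u) \<in> parcs G" if "u \<in> pverts G - Z" for u
    using \<sigma>[OF that] path(4) unfolding succ_def by metis
  ultimately show thesis using that by blast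
qed

text \<open>
  The path that starts at \<open>w \<in> W\<close> is the orbit of \<open>w\<close> under \<open>\<sigma>\<close> up to its first vertex in \<open>Z\<close>.
  Two such orbits cannot meet, and none can run into itself: by injectivity of \<open>\<sigma>\<close> a common vertex
  could be traced back to a starting point, and vertices of \<open>W\<close> are not values of \<open>\<sigma>\<close>. For the
  same reason the orbits end, as \<open>V\<close> is finite, and before its end an orbit contains no fixed
  point of \<open>\<sigma>\<close>, so that consecutive vertices are joined by arcs.
\<close>

lemma matching_imp_linked:
  assumes fin: "finite (pverts G)" and W: "W \<subseteq> pverts G" and Z: "Z \<subseteq> pverts G"
    and bij: "bij_betw \<sigma> (pverts G - Z) (pverts G - W)"
    and arc: "\<And>u. u \<in> pverts G - Z \<Longrightarrow> \<sigma> u = u \<or> (u, \<sigma> u) \<in> parcs G"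
  shows "linked G W Z"
proof -
  let ?V = "pverts G"
  have inj: "inj_on \<sigma> (?V - Z)" and range: "\<And>u. u \<in> ?V - Z \<Longrightarrow> \<sigma> u \<in> ?V - W"
    using bij unfolding bij_betw_def by auto
  have card_eq: "card W = card Z"
  proof -
    have "card ?V - card Z = card ?V - card W"
      using bij_betw_same_card[OF bij] fin W Z by (simp add: card_Diff_subset finite_subset)
    moreover have "card Z \<le> card ?V" "card W \<le> card ?V"
      using fin W Z card_mono by blast+
    ultimately show ?thesis by linarith
  qed
  have merge: "i = j \<and> w = w'"
    if "w \<in> W" "w' \<in> W" "\<And>k. k < i \<Longrightarrow> (\<sigma> ^^ k) w \<in> ?V - Z"
      "\<And>k. k < j \<Longrightarrow> (\<sigma> ^^ k) w' \<in> ?V - Z" "(\<sigma> ^^ i) w = (\<sigma> ^^ j) w'" for i j w w'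
    using that
  proof (induction i arbitrary: j)
    case 0
    then show ?case using range by (cases j) auto
  next
    case (Suc i)
    show ?case
    proof (cases j)
      case 0
      then have "\<sigma> ((\<sigma> ^^ i) w) = w'" using Suc.prems(5) by simp
      then show ?thesis using range[of "(\<sigma> ^^ i) w"] Suc.prems(2,3) by auto
    next
      case (Suc l)
      have "\<sigma> ((\<sigma> ^^ i) w) = \<sigma> ((\<sigma> ^^ l) w')" using Suc.prems(5) Suc by simp
      then have "(\<sigma> ^^ i) w = (\<sigma> ^^ l) w'"
        using inj_onD[OF inj] Suc.prems(3)[of i] Suc.prems(4)[of l] Suc by blast
      then show ?thesis using Suc.IH[of l] Suc.prems Suc by auto
    qed
  qed
  have reach: "\<exists>n. (\<sigma> ^^ n) w \<in> Z" if w: "w \<in> W" for w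
  proof (rule ccontr)
    assume "\<nexists>n. (\<sigma> ^^ n) w \<in> Z"
    then have notZ: "(\<sigma> ^^ n) w \<notin> Z" for n by blast
    have inV: "(\<sigma> ^^ n) w \<in> ?V - Z" for n
    proof (induction n)
      case 0
      then show ?case using w W notZ[of 0] by auto
    next
      case (Suc n)
      then show ?case using range notZ[of "Suc n"] by simp
    qed
    have "inj (\<lambda>n. (\<sigma> ^^ n) w)"
      using merge[OF w w inV inV] by (auto intro: injI)
    moreover have "finite (range (\<lambda>n. (\<sigma> ^^ n) w))"
      using inV fin by (meson finite_Diff finite_subset image_subset_iff)
    ultimately show False using finite_imageD infinite_UNIV_nat by blast
  qed
  define n where "n w = (LEAST n. (\<sigma> ^^ n) w \<in> Z)" for w
  have n: "(\<sigma> ^^ n w) w \<in> Z" if "w \<in> W" for w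
    unfolding n_def using reach[OF that] by (rule LeastI_ex)
  have before: "(\<sigma> ^^ k) w \<in> ?V - Z" if w: "w \<in> W" and "k < n w" for w k
    using \<open>k < n w\<close>
  proof (induction k)
    case 0
    then show ?case using w W not_less_Least unfolding n_def by force
  next
    case (Suc k)
    then have "(\<sigma> ^^ Suc k) w \<in> ?V" using range by simp
    moreover have "(\<sigma> ^^ Suc k) w \<notin> Z"
      using Suc.prems not_less_Least unfolding n_def by blast
    ultimately show ?case by blast
  qed
  define path where "path w = map (\<lambda>i. (\<sigma> ^^ i) w) [0..<Suc (n w)]" for w
  have length_path: "length (path w) = Suc (n w)" for w
    by (simp add: path_def)
  have nth_path: "path w ! i = (\<sigma> ^^ i) w" if "i \<le> n w" for w i
    using that by (simp add: path_def nth_append del: upt_Suc)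
  have path_nonempty: "path w \<noteq> []" for w
    using length_path[of w] by auto
  have hd_path: "hd (path w) = w" for w
    using nth_path[of 0 w] hd_conv_nth[OF path_nonempty, of w] by simp
  have last_path: "last (path w) = (\<sigma> ^^ n w) w" for w
    using nth_path[of "n w" w] last_conv_nth[OF path_nonempty, of w] by (simp add: length_path)
  have set_path: "set (path w) = (\<lambda>i. (\<sigma> ^^ i) w) ` {..n w}" for w
    by (auto simp: path_def simp del: upt_Suc)
  have merge_path: "i = j \<and> w = w'"
    if "w \<in> W" "w' \<in> W" "i \<le> n w" "j \<le> n w'" "(\<sigma> ^^ i) w = (\<sigma> ^^ j) w'" for i j w w'
    using merge[OF that(1,2) _ _ that(5)] before that by auto
  have vpath_path: "vpath (path w) (with_proj G)" if w: "w \<in> W" for w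
    unfolding vpath_iff
  proof (intro conjI allI impI)
    show "path w \<noteq> []" by (rule path_nonempty)
    show "distinct (path w)"
      using merge_path[OF w w] by (auto simp: distinct_conv_nth length_path nth_path)
    show "set (path w) \<subseteq> ?V"
      unfolding set_path using before[OF w] n[OF w] Z by (force simp: le_less)
    fix i assume "Suc i < length (path w)"
    then have i: "Suc i \<le> n w" by (simp add: length_path)
    have "(\<sigma> ^^ Suc i) w \<noteq> (\<sigma> ^^ i) w"
      using merge_path[OF w w, of "Suc i" i] i by auto
    then show "(path w ! i, path w ! Suc i) \<in> parcs G"
      using arc[OF before[OF w, of i]] i by (auto simp: nth_path)
  qed
  have disjoint: "set (path w) \<inter> set (path w') = {}" if "w \<in> W" "w' \<in> W" "w \<noteq> w'" for w w'
    unfolding set_path using merge_path[OF that(1,2)] that(3) by auto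
  have pairwise_disjoint: "pairwise (\<lambda>p q. set p \<inter> set q = {}) (path ` W)"
    using disjoint unfolding pairwise_def by blast
  have "inj_on path W"
    by (metis hd_path inj_onI)
  then have "card (path ` W) = card W" by (rule card_image)
  moreover have "last ` path ` W = Z"
  proof (rule card_subset_eq)
    show "finite Z" using Z fin finite_subset by blast
    show "last ` path ` W \<subseteq> Z" using n by (auto simp: last_path)
    have "inj_on (\<lambda>w. last (path w)) W"
      using merge_path by (auto intro!: inj_onI simp: last_path)
    then show "card (last ` path ` W) = card Z"
      using card_eq by (simp add: card_image image_image)
  qed
  moreover have "hd ` path ` W = W"
    by (simp add: image_image hd_path)
  ultimately show ?thesis
    unfolding linked_def using card_eq vpath_path pairwise_disjoint
    by (intro conjI exI[of _ "path ` W"]) blast+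
qed

lemma linked_subset:
  assumes "linked G U Z" "W \<subseteq> U" "finite U"
  obtains Z' where "Z' \<subseteq> Z" "linked G W Z'"
proof -
  obtain P where P: "\<And>p. p \<in> P \<Longrightarrow> vpath p (with_proj G)"
      "pairwise (\<lambda>p q. set p \<inter> set q = {}) P" "hd ` P = U" "last ` P = Z"
    using assms(1) unfolding linked_def by blast
  let ?P = "{p \<in> P. hd p \<in> W}"
  have ne: "p \<noteq> []" if "p \<in> P" for p
    using P(1)[OF that] unfolding vpath_iff by blast
  have inj: "inj_on f P" if f: "\<And>p. p \<in> P \<Longrightarrow> f p \<in> set p" for f
  proof (rule inj_onI, rule ccontr)
    fix p q assume pq: "p \<in> P" "q \<in> P" "f p = f q" "p \<noteq> q"
    then have "set p \<inter> set q = {}" using P(2) unfolding pairwise_def by blast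
    then show False using f[OF pq(1)] f[OF pq(2)] pq(3) by auto
  qed
  have "inj_on hd P" "inj_on last P"
    using inj[of hd] inj[of last] ne by simp_all
  then have "inj_on hd ?P" "inj_on last ?P"
    by (auto elim: inj_on_subset)
  moreover have hd: "hd ` ?P = W" using P(3) assms(2) by auto
  ultimately have "card ?P = card W" "card (last ` ?P) = card W"
    using card_image by metis+
  then have "linked G W (last ` ?P)"
    unfolding linked_def using P hd by (intro conjI exI[of _ ?P]) (auto intro: pairwise_subset)
  moreover have "last ` ?P \<subseteq> Z" using P(4) by blast
  ultimately show thesis using that by blast
qed


section \<open>Induction by bipartite graphs\<close>

text \<open>
  Induction by the bipartite graph in which \<open>u \<in> U\<close> is adjacent to the elements of \<open>A u\<close>. The two
  sides of the graph need not be disjoint, and \<open>A\<close> may leave the ground set of \<open>M\<close>.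
\<close>

definition bipartite_induced ::
    "'a set \<Rightarrow> ('a \<Rightarrow> 'a set) \<Rightarrow> 'a matroid_system \<Rightarrow> 'a matroid_system" where
  "bipartite_induced U A M =
     \<lparr> ground = U,
       indeps = {X. X \<subseteq> U \<and> (\<exists>\<phi>. inj_on \<phi> X \<and> (\<forall>x\<in>X. \<phi> x \<in> A x) \<and> \<phi> ` X \<in> indeps M)} \<rparr>"

lemma indep_bipartite_induced_iff:
  "X \<in> indeps (bipartite_induced U A M) \<longleftrightarrow>
     X \<subseteq> U \<and> (\<exists>\<phi>. inj_on \<phi> X \<and> (\<forall>x\<in>X. \<phi> x \<in> A x) \<and> \<phi> ` X \<in> indeps M)"
  by (simp add: bipartite_induced_def)

lemma ground_bipartite_induced: "ground (bipartite_induced U A M) = U"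
  by (simp add: bipartite_induced_def)

text \<open>
  With \<open>V\<close> larger than the ground set of \<open>M\<close>, this adjoins loops.
\<close>

lemma bipartite_induced_singletons:
  assumes "indeps M \<subseteq> Pow V"
  shows "bipartite_induced V (\<lambda>v. {v}) M = \<lparr> ground = V, indeps = indeps M \<rparr>"
proof -
  have "X \<in> indeps (bipartite_induced V (\<lambda>v. {v}) M) \<longleftrightarrow> X \<in> indeps M" for X
  proof
    assume "X \<in> indeps (bipartite_induced V (\<lambda>v. {v}) M)"
    then obtain \<phi> where "\<forall>x\<in>X. \<phi> x = x" "\<phi> ` X \<in> indeps M"
      by (auto simp: indep_bipartite_induced_iff)
    moreover from this have "\<phi> ` X = X" by force
    ultimately show "X \<in> indeps M" by simp
  next
    assume "X \<in> indeps M"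
    then show "X \<in> indeps (bipartite_induced V (\<lambda>v. {v}) M)"
      using assms unfolding indep_bipartite_induced_iff by (intro conjI exI[of _ id]) auto
  qed
  then show ?thesis by (auto simp: bipartite_induced_def)
qed

text \<open>
  The matroid obtained from \<open>M\<close> by adding the elements \<open>u \<in> S\<close> by principal extensions on
  \<open>A u \<inter> E(M)\<close> is induced by the bipartite graph \<open>A' S\<close>, in which old elements are matched only to
  themselves. In the extension by \<open>e\<close>, a matching of \<open>X\<close> and one of \<open>X\<close> with \<open>e\<close> replaced by
  \<open>y \<in> A e \<inter> E(M)\<close> correspond to each other by matching \<open>e\<close> to \<open>y\<close>.
\<close>

lemma bipartite_induced_insert:
  fixes A :: "'a \<Rightarrow> 'a set" and M :: "'a matroid_system"
  defines "A' \<equiv> \<lambda>S x. if x \<in> S then A x \<inter> ground M else {x}"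
  assumes M: "matroid (bipartite_induced (ground M \<union> S) (A' S) M)"
    and S: "S \<inter> ground M = {}" and e: "e \<notin> ground M" "e \<notin> S"
  shows "principal_extension (bipartite_induced (ground M \<union> S) (A' S) M) (A e \<inter> ground M) e
       = bipartite_induced (ground M \<union> insert e S) (A' (insert e S)) M"
    (is "principal_extension ?N ?Y e = ?N'")
proof -
  have "X \<in> indeps (principal_extension ?N ?Y e) \<longleftrightarrow> X \<in> indeps ?N'"
    if X: "X \<subseteq> insert e (ground M \<union> S)" for X
  proof -
    note iff = indep_principal_extension_iff[OF M, of ?Y e X, unfolded ground_bipartite_induced]
    show ?thesis
    proof (cases "e \<in> X")
      case False
      have A': "\<forall>x\<in>X. A' S x = A' (insert e S) x"
        using False by (auto simp: A'_def)
      show ?thesis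
        using iff e X False A' by (auto simp: indep_bipartite_induced_iff)
    next
      case True
      let ?X = "X - {e}"
      have "X \<in> indeps (principal_extension ?N ?Y e) \<longleftrightarrow> (\<exists>y\<in>?Y - X. insert y ?X \<in> indeps ?N)"
        using iff e X True by auto
      also have "\<dots> \<longleftrightarrow> X \<in> indeps ?N'"
      proof
        assume "\<exists>y\<in>?Y - X. insert y ?X \<in> indeps ?N"
        then obtain y \<phi> where y: "y \<in> ?Y" "y \<notin> X"
          and \<phi>: "inj_on \<phi> (insert y ?X)" "\<And>x. x \<in> insert y ?X \<Longrightarrow> \<phi> x \<in> A' S x"
            "\<phi> ` insert y ?X \<in> indeps M"
          unfolding indep_bipartite_induced_iff by blast
        have "y \<notin> S" using y S by blast
        then have \<phi>y: "\<phi> y = y" using \<phi>(2)[of y] by (simp add: A'_def)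
        let ?\<psi> = "\<phi>(e := y)"
        have Xe: "X = insert e ?X" using True by blast
        have im: "?\<psi> ` X = \<phi> ` insert y ?X"
        proof -
          have "?\<psi> ` ?X = \<phi> ` ?X" by (rule image_cong) auto
          then have "?\<psi> ` insert e ?X = \<phi> ` insert y ?X" unfolding image_insert \<phi>y by simp
          then show ?thesis using Xe by metis
        qed
        have "inj_on ?\<psi> (insert e ?X)"
          using \<phi>(1) \<phi>y y by (auto simp: inj_on_def)
        then have "inj_on ?\<psi> X" using Xe by simp
        moreover have "?\<psi> x \<in> A' (insert e S) x" if "x \<in> X" for x
          using \<phi>(2)[of x] that y(1) by (cases "x = e") (auto simp: A'_def)
        ultimately show "X \<in> indeps ?N'"
          unfolding indep_bipartite_induced_iff using im \<phi>(3) X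
          by (intro conjI exI[of _ ?\<psi>]) auto
      next
        assume "X \<in> indeps ?N'"
        then obtain \<phi> where \<phi>: "inj_on \<phi> X" "\<And>x. x \<in> X \<Longrightarrow> \<phi> x \<in> A' (insert e S) x"
            "\<phi> ` X \<in> indeps M"
          unfolding indep_bipartite_induced_iff by blast
        define y where "y = \<phi> e"
        have y: "y \<in> ?Y" using \<phi>(2)[OF True] by (simp add: A'_def y_def)
        \<comment> \<open>Elements of \<open>E(M)\<close> are matched to themselves, so \<open>y \<in> X\<close> would be hit twice.\<close>
        have "y \<notin> X"
        proof
          assume "y \<in> X"
          moreover have "y \<notin> insert e S" using y S e by blast
          ultimately have "\<phi> y = \<phi> e" using \<phi>(2)[of y] by (simp add: A'_def y_def)
          then show False using inj_onD[OF \<phi>(1) _ \<open>y \<in> X\<close> True] \<open>y \<notin> insert e S\<close> by blast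
        qed
        let ?\<psi> = "\<phi>(y := y)"
        have im: "?\<psi> ` insert y ?X = \<phi> ` X"
          using True \<open>y \<notin> X\<close> by (auto simp: y_def)
        have "y \<notin> \<phi> ` ?X"
          using inj_onD[OF \<phi>(1)] True by (auto simp: y_def)
        then have "inj_on ?\<psi> (insert y ?X)"
          using \<phi>(1) \<open>y \<notin> X\<close> by (auto simp: inj_on_def)
        moreover have "?\<psi> x \<in> A' S x" if "x \<in> insert y ?X" for x
          using \<phi>(2)[of x] that \<open>y \<notin> X\<close> y S by (cases "x = y") (auto simp: A'_def)
        ultimately have "insert y ?X \<in> indeps ?N"
          unfolding indep_bipartite_induced_iff using im \<phi>(3) X y
          by (intro conjI exI[of _ ?\<psi>]) auto
        then show "\<exists>y\<in>?Y - X. insert y ?X \<in> indeps ?N"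
          using y \<open>y \<notin> X\<close> by blast
      qed
      finally show ?thesis .
    qed
  qed
  moreover have "indeps (principal_extension ?N ?Y e) \<subseteq> Pow (insert e (ground M \<union> S))"
    by (auto simp: principal_extension_def bipartite_induced_def)
  moreover have "indeps ?N' \<subseteq> Pow (insert e (ground M \<union> S))"
    by (auto simp: indep_bipartite_induced_iff)
  ultimately have "indeps (principal_extension ?N ?Y e) = indeps ?N'"
    by blast
  then show ?thesis
    by (simp add: principal_extension_def bipartite_induced_def)
qed

text \<open>
  The set \<open>U\<close> may meet the ground set of \<open>M\<close>, but principal extensions add new elements. Hence they
  are applied to a disjoint copy \<open>S\<close> of \<open>U\<close>, which exists because the type is infinite; closure
  under isomorphism transports the result back to \<open>U\<close>.
\<close>

lemma closed_bipartite_induction: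
  fixes \<C> :: "'a matroid_system set"
  assumes inf: "infinite (UNIV :: 'a set)" and iso: "matroid_class \<C>"
    and minors: "closed_minors \<C>" and ext: "closed_principal_extension \<C>"
    and M: "M \<in> \<C>" and U: "finite U"
  shows "bipartite_induced U A M \<in> \<C>"
proof -
  have matroid: "matroid N" if "N \<in> \<C>" for N
    using iso that unfolding matroid_class_def by blast
  have indeps_M: "indeps M \<subseteq> Pow (ground M)"
    using matroidD(2) matroid M by blast
  obtain S where S: "finite S" "card S = card U" "S \<subseteq> - ground M"
    using infinite_arbitrarily_large[of "- ground M" "card U"] inf matroidD(1)[OF matroid[OF M]]
    by (metis Compl_eq_Diff_UNIV Diff_infinite_finite)
  then obtain g where g: "bij_betw g S U"
    using U finite_same_card_bij by blast
  define c where "c = inv_into S g"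
  have c: "c (g x) = x" if "x \<in> S" for x
    using g that by (simp add: c_def bij_betw_inv_into_left)
  let ?A = "\<lambda>x. A (g x)"
  let ?A' = "\<lambda>T x. if x \<in> T then ?A x \<inter> ground M else {x}"
  let ?N = "\<lambda>T. bipartite_induced (ground M \<union> T) (?A' T) M"
  have "?N S \<in> \<C>"
    using S(1,3)
  proof (induction S)
    case empty
    have "?N {} = M" using bipartite_induced_singletons[OF indeps_M] by simp
    then show ?case using M by simp
  next
    case (insert e T)
    then have N: "?N T \<in> \<C>" by blast
    have "?A e \<inter> ground M \<subseteq> ground (?N T)" "e \<notin> ground (?N T)"
      using insert.hyps insert.prems by (auto simp only: ground_bipartite_induced)
    then have "principal_extension (?N T) (?A e \<inter> ground M) e \<in> \<C>"
      using ext[unfolded closed_principal_extension_def, rule_format, OF N] by blast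
    moreover have "T \<inter> ground M = {}" using insert.prems by blast
    ultimately show ?case
      using bipartite_induced_insert[of M T ?A e, OF matroid[OF N]] insert.hyps insert.prems by simp
  qed
  moreover from this have "minor_of (delete (?N S) (ground M)) (?N S)"
    by (intro minor_of_delete matroid) (simp_all add: ground_bipartite_induced)
  ultimately have "delete (?N S) (ground M) \<in> \<C>"
    using minors unfolding closed_minors_def by blast
  moreover have "delete (?N S) (ground M) = bipartite_induced S ?A M"
  proof -
    have "X \<in> indeps (?N S) \<longleftrightarrow> X \<in> indeps (bipartite_induced S ?A M)" if X: "X \<subseteq> S" for X
    proof -
      have "(\<forall>x\<in>X. \<phi> x \<in> ?A' S x) \<and> \<phi> ` X \<in> indeps M \<longleftrightarrow>
          (\<forall>x\<in>X. \<phi> x \<in> ?A x) \<and> \<phi> ` X \<in> indeps M" for \<phi>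
        using X indeps_M by (auto simp: subset_iff)
      then show ?thesis
        unfolding indep_bipartite_induced_iff using X by auto
    qed
    then have "{X \<in> indeps (?N S). X \<subseteq> S} = indeps (bipartite_induced S ?A M)"
      using indep_bipartite_induced_iff[of _ S ?A M] by blast
    moreover have "ground M \<union> S - ground M = S" using S(3) by blast
    ultimately show ?thesis
      unfolding delete_def ground_bipartite_induced
      by (simp add: bipartite_induced_def[of S])
  qed
  ultimately have copy: "bipartite_induced S ?A M \<in> \<C>" by simp
  have "matroid_iso (bipartite_induced S ?A M) (bipartite_induced U A M)"
    unfolding matroid_iso_def ground_bipartite_induced
  proof (intro exI[of _ g] conjI allI impI)
    fix X assume X: "X \<subseteq> S"
    have gX: "g ` X \<subseteq> U" using X g unfolding bij_betw_def by blast
    show "X \<in> indeps (bipartite_induced S ?A M) \<longleftrightarrow> g ` X \<in> indeps (bipartite_induced U A M)"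
    proof
      assume "X \<in> indeps (bipartite_induced S ?A M)"
      then obtain \<phi> where \<phi>: "inj_on \<phi> X" "\<forall>x\<in>X. \<phi> x \<in> ?A x" "\<phi> ` X \<in> indeps M"
        unfolding indep_bipartite_induced_iff by blast
      have cX: "\<And>x. x \<in> X \<Longrightarrow> c (g x) = x" using c X by blast
      have "(\<lambda>u. \<phi> (c u)) ` g ` X = \<phi> ` X"
        using cX by (force simp: image_image)
      moreover have "inj_on (\<lambda>u. \<phi> (c u)) (g ` X)"
        using \<phi>(1) cX by (auto simp: inj_on_def)
      ultimately show "g ` X \<in> indeps (bipartite_induced U A M)"
        unfolding indep_bipartite_induced_iff using gX \<phi> cX
        by (intro conjI exI[of _ "\<lambda>u. \<phi> (c u)"]) auto
    next
      assume "g ` X \<in> indeps (bipartite_induced U A M)"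
      then obtain \<phi> where \<phi>: "inj_on \<phi> (g ` X)" "\<forall>x\<in>g ` X. \<phi> x \<in> A x" "\<phi> ` g ` X \<in> indeps M"
        unfolding indep_bipartite_induced_iff by blast
      have "inj_on g X" using g X inj_on_subset unfolding bij_betw_def by blast
      then have "inj_on (\<lambda>x. \<phi> (g x)) X"
        using \<phi>(1) by (auto simp: inj_on_def)
      then show "X \<in> indeps (bipartite_induced S ?A M)"
        unfolding indep_bipartite_induced_iff using X \<phi>
        by (intro conjI exI[of _ "\<lambda>x. \<phi> (g x)"]) (auto simp: image_image)
    qed
  qed (use g in simp)
  moreover from this have "matroid (bipartite_induced U A M)"
    by (rule matroid_iso_matroid[OF matroid[OF copy]])
      (auto simp: indep_bipartite_induced_iff ground_bipartite_induced)
  ultimately show ?thesis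
    using iso copy unfolding matroid_class_def by blast
qed


section \<open>Induction by digraphs and by bipartite graphs\<close>

text \<open>
  The complement of a basis \<open>D\<close> of \<open>M\<close> is matched to itself, so every basis of \<open>N\<close> has \<open>|V| - |D|\<close>
  elements and is matched onto the complement of a basis. Thus, if \<open>W\<close> is independent in the
  dual of \<open>N\<close>, the linkage lemma turns the matching of a basis of \<open>N\<close> disjoint from \<open>W\<close> into a linking of
  a superset of \<open>W\<close> to a basis of \<open>M\<close>. Conversely, a linking of \<open>W\<close> to \<open>Z\<close> yields a bijection from \<open>V - Z\<close>
  to \<open>V - W\<close>; extending \<open>Z\<close> to a basis \<open>D\<close> and restricting the bijection to \<open>V - D\<close> produces a
  basis of \<open>N\<close> disjoint from \<open>W\<close>.

  That \<open>N\<close> is a matroid is a hypothesis since in the application \<open>N\<close> is a member of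
  a class of matroids.
\<close>

lemma induced_matroid_eq_dual_bipartite_induced_dual:
  fixes G :: "'a pair_pre_digraph" and M :: "'a matroid_system"
  defines "N \<equiv> bipartite_induced (pverts G) (\<lambda>v. {u \<in> pverts G. u = v \<or> (u, v) \<in> parcs G}) (dual M)"
  assumes M: "matroid M" and V: "ground M = pverts G" and N: "matroid N"
  shows "induced_matroid G M = dual N"
proof -
  let ?V = "pverts G"
  have fin: "finite ?V" using matroidD(1)[OF M] V by simp
  have ground_N: "ground N = ?V" by (simp add: N_def ground_bipartite_induced)
  have basis_V: "B \<subseteq> ?V" if "B \<in> bases M" for B
    using basis_subset_ground[OF M that] V by simp
  have card_compl: "card (?V - B) = card ?V - card B" if "B \<subseteq> ?V" for B
    using that fin by (simp add: card_Diff_subset finite_subset)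
  have indep_dual: "I \<in> indeps (dual M) \<longleftrightarrow> (\<exists>B\<in>bases M. I \<subseteq> ?V - B)" for I
    by (simp add: dual_def V)
  have indep_N: "X \<in> indeps N \<longleftrightarrow> X \<subseteq> ?V \<and> (\<exists>\<phi>. inj_on \<phi> X \<and>
      (\<forall>x\<in>X. \<phi> x \<in> ?V \<and> (\<phi> x = x \<or> (\<phi> x, x) \<in> parcs G)) \<and> \<phi> ` X \<in> indeps (dual M))" for X
    by (simp add: N_def indep_bipartite_induced_iff)
  have "W \<in> indeps (induced_matroid G M) \<longleftrightarrow> W \<in> indeps (dual N)" for W
  proof
    assume "W \<in> indeps (dual N)"
    then obtain B where B: "B \<in> bases N" "W \<subseteq> ?V - B"
      by (auto simp: dual_def ground_N)
    have BV: "B \<subseteq> ?V" using basis_subset_ground[OF N B(1)] ground_N by simp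
    obtain \<phi> D where \<phi>: "inj_on \<phi> B" "\<forall>x\<in>B. \<phi> x \<in> ?V \<and> (\<phi> x = x \<or> (\<phi> x, x) \<in> parcs G)"
      and D: "D \<in> bases M" "\<phi> ` B \<subseteq> ?V - D"
      using B(1) unfolding bases_def[of N] mem_Collect_eq indep_N indep_dual by blast
    \<comment> \<open>The identity matching bounds the size of the basis \<open>B\<close> from below.\<close>
    have "?V - D \<in> indeps N"
      unfolding indep_N indep_dual using D(1) by (intro conjI exI[of _ id]) auto
    then have "card (?V - D) \<le> card (\<phi> ` B)"
      using indep_card_le_basis_card[OF N _ B(1)] card_image[OF \<phi>(1)] by simp
    then have "\<phi> ` B = ?V - D"
      using card_seteq[OF _ D(2)] fin by blast
    then have bij: "bij_betw \<phi> B (?V - D)"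
      using \<phi>(1) unfolding bij_betw_def by blast
    have "linked G (?V - B) D"
    proof (rule matching_imp_linked[OF fin])
      show "D \<subseteq> ?V" using basis_V[OF D(1)] .
      show "bij_betw (inv_into B \<phi>) (?V - D) (?V - (?V - B))"
        using bij_betw_inv_into[OF bij] BV by (simp add: double_diff)
      fix u assume u: "u \<in> ?V - D"
      define x where "x = inv_into B \<phi> u"
      have "x \<in> B" "\<phi> x = u"
        using bij u unfolding x_def
        by (auto simp: bij_betw_inv_into_right intro: bij_betwE[OF bij_betw_inv_into[OF bij], rule_format])
      then show "inv_into B \<phi> u = u \<or> (u, inv_into B \<phi> u) \<in> parcs G"
        using \<phi>(2) by (auto simp flip: x_def)
    qed blast
    then obtain Z where Z: "Z \<subseteq> D" "linked G W Z"
      using linked_subset[OF _ B(2)] fin by blast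
    have "Z \<in> indeps M" using Z(1) D(1) matroidD(4)[OF M] unfolding bases_def by blast
    then show "W \<in> indeps (induced_matroid G M)"
      using Z(2) B(2) by (auto simp: induced_matroid_def)
  next
    assume "W \<in> indeps (induced_matroid G M)"
    then obtain Z where W: "W \<subseteq> ?V" and Z: "Z \<in> indeps M" "linked G W Z"
      by (auto simp: induced_matroid_def)
    have "Z \<subseteq> ?V" using indep_subset_ground[OF M Z(1)] V by simp
    then obtain \<sigma> where bij: "bij_betw \<sigma> (?V - Z) (?V - W)"
      and \<sigma>: "\<And>u. u \<in> ?V - Z \<Longrightarrow> \<sigma> u = u \<or> (u, \<sigma> u) \<in> parcs G"
      using linked_imp_matching[OF fin W _ Z(2)] by metis
    obtain D where D: "D \<in> bases M" "Z \<subseteq> D"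
      using indep_extends_to_basis[OF M Z(1)] by blast
    define B where "B = \<sigma> ` (?V - D)"
    have DZ: "?V - D \<subseteq> ?V - Z" using D(2) by blast
    have inj: "inj_on \<sigma> (?V - D)"
      using bij inj_on_subset[OF _ DZ] unfolding bij_betw_def by blast
    have BW: "B \<subseteq> ?V - W" using bij DZ unfolding B_def bij_betw_def by blast
    have card_B: "card B = card ?V - card D"
      using card_image[OF inj] card_compl[OF basis_V[OF D(1)]] by (simp add: B_def)
    have "B \<in> indeps N"
      unfolding indep_N
    proof (intro conjI exI[of _ "inv_into (?V - D) \<sigma>"] ballI)
      show "B \<subseteq> ?V" using BW by blast
      show "inj_on (inv_into (?V - D) \<sigma>) B" unfolding B_def by (rule inj_on_inv_into) simp
      show "inv_into (?V - D) \<sigma> ` B \<in> indeps (dual M)"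
        unfolding indep_dual B_def using inj D(1) by auto
      fix x assume "x \<in> B"
      then obtain u where u: "u \<in> ?V - D" "x = \<sigma> u" unfolding B_def by blast
      then have "inv_into (?V - D) \<sigma> x = u" using inj by simp
      then show "inv_into (?V - D) \<sigma> x \<in> ?V"
        "inv_into (?V - D) \<sigma> x = x \<or> (inv_into (?V - D) \<sigma> x, x) \<in> parcs G"
        using u \<sigma>[of u] DZ by auto
    qed
    moreover have "I = B" if I: "I \<in> indeps N" "B \<subseteq> I" for I
    proof -
      obtain \<phi> D' where \<phi>: "inj_on \<phi> I" and D': "D' \<in> bases M" "\<phi> ` I \<subseteq> ?V - D'"
        using I(1) unfolding indep_N indep_dual by blast
      have "card I \<le> card (?V - D')"
        using card_mono[OF _ D'(2)] fin card_image[OF \<phi>] by simp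
      also have "\<dots> = card ?V - card D'" using card_compl basis_V D'(1) by blast
      also have "\<dots> \<le> card B"
        using indep_card_le_basis_card[OF M _ D'(1), of D] D(1) card_B
        unfolding bases_def by simp
      finally show ?thesis
        using card_seteq[OF _ I(2)] indep_finite[OF N I(1)] by blast
    qed
    ultimately have "B \<in> bases N" unfolding bases_def by blast
    then show "W \<in> indeps (dual N)"
      using BW W by (auto simp: dual_def ground_N)
  qed
  then show ?thesis
    by (auto simp: induced_matroid_def dual_def ground_N)
qed

text \<open>
  Since \<open>e\<close> is the only vertex with outgoing arcs, the bijection of the linkage lemma fixes
  everything but possibly \<open>e\<close>; so \<open>Z\<close> is \<open>W\<close> or arises from it by replacing \<open>e\<close> by an element of
  \<open>Y\<close>.
\<close>

lemma principal_extension_eq_induced_matroid: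
  assumes M: "matroid M" and Y: "Y \<subseteq> ground M" and e: "e \<notin> ground M"
  defines "G \<equiv> \<lparr> pverts = insert e (ground M), parcs = {e} \<times> Y \<rparr>"
  shows "principal_extension M Y e = induced_matroid G M"
proof -
  let ?V = "insert e (ground M)"
  have G: "pverts G = ?V" "parcs G = {e} \<times> Y" by (simp_all add: G_def)
  have fin: "finite (pverts G)" using matroidD(1)[OF M] G by simp
  have "W \<in> indeps (principal_extension M Y e) \<longleftrightarrow> (\<exists>Z\<in>indeps M. linked G W Z)"
    if W: "W \<subseteq> ?V" for W
  proof
    assume "\<exists>Z\<in>indeps M. linked G W Z"
    then obtain Z where Z: "Z \<in> indeps M" "linked G W Z" by blast
    have ZE: "Z \<subseteq> ground M" using indep_subset_ground[OF M Z(1)] .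
    obtain \<sigma> where bij: "bij_betw \<sigma> (?V - Z) (?V - W)"
      and arc: "\<And>u. u \<in> ?V - Z \<Longrightarrow> \<sigma> u = u \<or> (u, \<sigma> u) \<in> {e} \<times> Y"
      using linked_imp_matching[OF fin _ _ Z(2)] W ZE unfolding G by (metis subset_insertI2)
    have \<sigma>: "\<sigma> u = u" if "u \<in> ?V - Z" "u \<noteq> e" for u
      using arc that by blast
    have "e \<in> ?V - Z" using e ZE by blast
    then have "?V - Z = insert e (ground M - Z)" using e by blast
    moreover have "\<sigma> ` (ground M - Z) = ground M - Z"
      using \<sigma> e by force
    ultimately have im: "insert (\<sigma> e) (ground M - Z) = ?V - W"
      using bij unfolding bij_betw_def by (metis image_insert)
    have W_eq: "W = ?V - insert (\<sigma> e) (ground M - Z)"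
      unfolding im using W by (simp add: double_diff)
    have \<sigma>e: "\<sigma> e = e \<or> \<sigma> e \<in> Y" using arc[OF \<open>e \<in> ?V - Z\<close>] by simp
    have notin: "\<sigma> e \<notin> ground M - Z"
    proof
      assume v: "\<sigma> e \<in> ground M - Z"
      then have "\<sigma> e \<in> ?V - Z" "\<sigma> e \<noteq> e" using e by auto
      then have "\<sigma> (\<sigma> e) = \<sigma> e" by (rule \<sigma>)
      then have "\<sigma> e = e"
        using inj_onD[OF bij_betw_imp_inj_on[OF bij]] v \<open>e \<in> ?V - Z\<close> by blast
      then show False using v e by simp
    qed
    show "W \<in> indeps (principal_extension M Y e)"
      unfolding indep_principal_extension_iff[OF M Y e W]
    proof (cases "e \<in> W")
      case False
      then have "\<sigma> e = e" unfolding W_eq using e by simp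
      then have "W = Z" unfolding W_eq using ZE e by auto
      then show "if e \<in> W then \<exists>y\<in>Y - W. insert y (W - {e}) \<in> indeps M else W \<in> indeps M"
        using Z(1) False by simp
    next
      case True
      then have "\<sigma> e \<in> Y" "\<sigma> e \<notin> W" using \<sigma>e W_eq by auto
      moreover have "\<sigma> e \<in> Z" "e \<notin> Z" using notin \<open>\<sigma> e \<in> Y\<close> Y ZE e by auto
      then have "insert (\<sigma> e) (W - {e}) = Z"
        unfolding W_eq using ZE by auto
      ultimately show "if e \<in> W then \<exists>y\<in>Y - W. insert y (W - {e}) \<in> indeps M else W \<in> indeps M"
        using Z(1) True by auto
    qed
  next
    assume "W \<in> indeps (principal_extension M Y e)"
    then have *: "if e \<in> W then \<exists>y\<in>Y - W. insert y (W - {e}) \<in> indeps M else W \<in> indeps M"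
      using indep_principal_extension_iff[OF M Y e W] by blast
    show "\<exists>Z\<in>indeps M. linked G W Z"
    proof (cases "e \<in> W")
      case False
      have "linked G W W"
        using matching_imp_linked[OF fin, of W W id] W G by auto
      then show ?thesis using * False by auto
    next
      case True
      then obtain y where y: "y \<in> Y - W" "insert y (W - {e}) \<in> indeps M" using * by auto
      let ?Z = "insert y (W - {e})"
      have "linked G W ?Z"
      proof (rule matching_imp_linked[OF fin])
        show "W \<subseteq> pverts G" "?Z \<subseteq> pverts G" using W y Y G by auto
        define K where "K = ground M - ?Z"
        have "?V - ?Z = insert e K" "?V - W = insert y K"
          using True y Y W e unfolding K_def by auto
        moreover have "e \<notin> K" "y \<notin> K" using e unfolding K_def by auto
        then have "bij_betw (id(e := y)) (insert e K) (insert y K)"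
          by (auto simp: bij_betw_def inj_on_def)
        ultimately show "bij_betw (id(e := y)) (pverts G - ?Z) (pverts G - W)"
          unfolding G by metis
        show "(id(e := y)) u = u \<or> (u, (id(e := y)) u) \<in> parcs G" for u
          using y G by auto
      qed
      then show ?thesis using y by blast
    qed
  qed
  then show ?thesis
    by (auto simp: principal_extension_def induced_matroid_def G)
qed


section \<open>Complete classes\<close>

lemma closed_digraph_induction_if_closed_principal_extension:
  fixes \<C> :: "'a matroid_system set"
  assumes "infinite (UNIV :: 'a set)" "matroid_class \<C>" "closed_minors \<C>" "closed_duals \<C>"
    "closed_principal_extension \<C>"
  shows "closed_digraph_induction \<C>"
  unfolding closed_digraph_induction_def
proof (intro ballI allI impI)
  fix M :: "'a matroid_system" and G :: "'a pair_pre_digraph"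
  assume M: "M \<in> \<C>" and G: "pair_fin_digraph G" and V: "ground M \<subseteq> pverts G"
  have matroid: "matroid N" if "N \<in> \<C>" for N
    using assms(2) that unfolding matroid_class_def by blast
  have bip: "bipartite_induced (pverts G) A N \<in> \<C>" if "N \<in> \<C>" for A N
    using closed_bipartite_induction[OF assms(1,2,3,5) that] pair_fin_digraph.pair_finite_verts[OF G]
    by blast
  have dual: "dual N \<in> \<C>" if "N \<in> \<C>" for N
    using assms(4) that unfolding closed_duals_def by blast
  let ?M = "\<lparr> ground = pverts G, indeps = indeps M \<rparr>"
  let ?N = "bipartite_induced (pverts G) (\<lambda>v. {u \<in> pverts G. u = v \<or> (u, v) \<in> parcs G}) (dual ?M)"
  \<comment> \<open>Adjoining the other vertices as loops changes neither the independent sets nor \<open>\<Gamma>(M)\<close>.\<close>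
  have "bipartite_induced (pverts G) (\<lambda>v. {v}) M = ?M"
    using bipartite_induced_singletons matroidD(2)[OF matroid[OF M]] V by blast
  then have M': "?M \<in> \<C>" using bip[OF M] by metis
  then have N: "?N \<in> \<C>" using bip dual by blast
  have "induced_matroid G ?M = dual ?N"
    by (rule induced_matroid_eq_dual_bipartite_induced_dual) (use matroid M' N in auto)
  moreover have "induced_matroid G M = induced_matroid G ?M"
    by (simp add: induced_matroid_def)
  ultimately show "induced_matroid G M \<in> \<C>"
    using dual[OF N] by simp
qed

lemma closed_truncations_if_closed_principal_extension:
  assumes "closed_minors \<C>" "closed_principal_extension \<C>"
  shows "closed_truncations \<C>"
  unfolding closed_truncations_def truncation_def
proof (intro ballI allI impI)
  fix M e assume "M \<in> \<C>" "e \<notin> ground M"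
  then have "principal_extension M (ground M) e \<in> \<C>"
    using assms(2) unfolding closed_principal_extension_def by blast
  then show "contract (principal_extension M (ground M) e) {e} \<in> \<C>"
    using assms(1) minor_of_contract[of "{e}" "principal_extension M (ground M) e"]
    unfolding closed_minors_def by (simp add: principal_extension_def)
qed

lemma closed_principal_extension_if_closed_digraph_induction:
  assumes "matroid_class \<C>" "closed_digraph_induction \<C>"
  shows "closed_principal_extension \<C>"
  unfolding closed_principal_extension_def
proof (intro ballI allI impI)
  fix M Y e assume M: "M \<in> \<C>" and Y: "Y \<subseteq> ground M" and e: "e \<notin> ground M"
  let ?G = "\<lparr> pverts = insert e (ground M), parcs = {e} \<times> Y \<rparr>"
  have "matroid M" using assms(1) M unfolding matroid_class_def by blast
  then have "pair_fin_digraph ?G"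
    using Y matroidD(1) by unfold_locales (auto intro: finite_subset)
  then have "induced_matroid ?G M \<in> \<C>"
    using assms(2)[unfolded closed_digraph_induction_def, rule_format, OF M, of ?G] by auto
  then show "principal_extension M Y e \<in> \<C>"
    using principal_extension_eq_induced_matroid[OF \<open>matroid M\<close> Y e] by simp
qed

theorem theorem6p1:
  fixes \<C> :: "'a matroid_system set"
  assumes "infinite (UNIV :: 'a set)"
    and "matroid_class \<C>"
  shows "complete_class \<C> \<longleftrightarrow>
    closed_minors \<C> \<and> closed_duals \<C> \<and> closed_direct_sums \<C> \<and> closed_principal_extension \<C>"
  using assms closed_principal_extension_if_closed_digraph_induction
    closed_truncations_if_closed_principal_extension
    closed_digraph_induction_if_closed_principal_extension
  unfolding complete_class_def by blast

end
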